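(* Let $n\ge3$ and $1<p<\infty$. (i) For every admissible potential $V$ on $\mathbb{R}^n$ (with associated classes $A_p^\infty$ and $\mathrm{BMO}_\infty$), if $w\in A_p^\infty$ then $\log w\in \mathrm{BMO}_\infty$. (ii) The converse is not true in general: there exist an admissible potential $V$ on $\mathbb{R}^n$ and a weight $w$ such that $\log w\in\mathrm{BMO}_\infty$ but $w\notin A_p^\infty$ (for the classes associated to $L=-\Delta+V$).
   Context: A potential $V$ on $\mathbb{R}^n$ is called admissible here if $V\ge 0$ is a locally integrable function in the reverse Hölder class $RH_s$ for some $s\ge n/2$: there is a constant $C_V$ with $\big(\frac1{|Q|}\int_Q V^s\big)^{1/s}\le \frac{C_V}{|Q|}\int_Q V$ for all cubes $Q$ (left side replaced by the essential supremum over $Q$ if $s=\infty$). Put $L=-\Delta+V$. The critical function is $$\rho(x)=\sup\Big\{r>0:\ \frac1{r^{n-2}}\int_{B(x,r)}V(y)\,dy\le 1\Big\}$$ (if $V\equiv0$ then $\rho=\infty$ and $\ell/\rho$ is read as $0$). All cubes have sides parallel to the axes; $c_Q$, $\ell(Q)$, $|Q|$ denote the center, side-length and volume of $Q$. For $\theta\ge0$ set $\psi_\theta(Q)=\big(1+\frac{\ell(Q)}{\rho(c_Q)}\big)^\theta$. A weight is a non-negative (a.e. positive) locally integrable function, and $p'=p/(p-1)$. The class $A_p^\theta$ consists of the weights with $$[w]_{A_p^\theta}=\sup_Q\Big(\frac1{\psi_\theta(Q)|Q|}\int_Q w\Big)\Big(\frac1{\psi_\theta(Q)|Q|}\int_Q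 w^{-p'/p}\Big)^{p/p'}<\infty ,$$ and $A_p^\infty=\bigcup_{\theta\ge0}A_p^\theta$. The space $\mathrm{BMO}_\theta$ consists of the locally integrable $f$ with $$\sup_Q\frac1{\psi_\theta(Q)|Q|}\int_Q|f(y)-\langle f\rangle_Q|\,dy<\infty,\qquad \langle f\rangle_Q=\frac1{|Q|}\int_Qf,$$ and $\mathrm{BMO}_\infty=\bigcup_{\theta\ge0}\mathrm{BMO}_\theta$. *)

theory Defs
  imports "HOL-Analysis.Analysis" "HOL-Probability.Essential_Supremum"
begin

definition locally_integrable :: "('a::euclidean_space \<Rightarrow> real) \<Rightarrow> bool" where
  "locally_integrable f \<longleftrightarrow> (\<forall>K. compact K \<longrightarrow> f absolutely_integrable_on K)"

definition cube :: "'a::euclidean_space \<Rightarrow> real \<Rightarrow> 'a set" where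
  "cube c l = cbox (c - (l / 2) *\<^sub>R One) (c + (l / 2) *\<^sub>R One)"

text \<open>Real powers of extended nonnegative reals; used only for exponents \<open>a > 0\<close>.\<close>

definition ennpowr :: "ennreal \<Rightarrow> real \<Rightarrow> ennreal" where
  "ennpowr x a = (if x = \<infinity> then \<infinity> else ennreal (enn2real x powr a))"

definition power_mean :: "ennreal \<Rightarrow> 'a::euclidean_space set \<Rightarrow> ('a \<Rightarrow> real) \<Rightarrow> ennreal" where
  "power_mean s Q V =
     (if s = \<infinity> then esssup (restrict_space lebesgue Q) (\<lambda>y. ennreal (V y))
      else ennpowr ((\<integral>\<^sup>+ y\<in>Q. ennreal (V y powr enn2real s) \<partial>lebesgue) / emeasure lebesgue Q)
             (1 / enn2real s))"

definition reverse_Hoelder :: "ennreal \<Rightarrow> ('a::euclidean_space \<Rightarrow> real) \<Rightarrow> bool" where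
  "reverse_Hoelder s V \<longleftrightarrow>
     (\<exists>C::real. \<forall>c. \<forall>l>0. power_mean s (cube c l) V
        \<le> ennreal C * ((\<integral>\<^sup>+ y\<in>cube c l. ennreal (V y) \<partial>lebesgue) / emeasure lebesgue (cube c l)))"

definition admissible :: "('a::euclidean_space \<Rightarrow> real) \<Rightarrow> bool" where
  "admissible V \<longleftrightarrow> (\<forall>x. 0 \<le> V x) \<and> locally_integrable V \<and>
     (\<exists>s\<ge>ennreal (real DIM('a) / 2). reverse_Hoelder s V)"

definition critical_fun :: "('a::euclidean_space \<Rightarrow> real) \<Rightarrow> 'a \<Rightarrow> ennreal" where
  "critical_fun V x =
     Sup (ennreal ` {r. 0 < r \<and>
       (\<integral>\<^sup>+ y\<in>ball x r. ennreal (V y) \<partial>lebesgue) / ennreal (r ^ (DIM('a) - 2)) \<le> 1})"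

text \<open>
  The quotient \<open>l / \<rho>(c)\<close> is taken in \<^typ>\<open>ennreal\<close>, so that it is \<open>0\<close> if \<open>\<rho>(c) = \<infinity>\<close>.
  For admissible \<open>V\<close> and \<open>n \<ge> 3\<close>, Hoelder's inequality gives \<open>\<rho>(c) > 0\<close>, so
  \<^const>\<open>enn2real\<close> is applied to finite values only.
\<close>

definition psi :: "('a::euclidean_space \<Rightarrow> real) \<Rightarrow> real \<Rightarrow> 'a \<Rightarrow> real \<Rightarrow> real" where
  "psi V \<theta> c l = (1 + enn2real (ennreal l / critical_fun V c)) powr \<theta>"

definition weight :: "('a::euclidean_space \<Rightarrow> real) \<Rightarrow> bool" where
  "weight w \<longleftrightarrow> (\<forall>x. 0 \<le> w x) \<and> (AE x in lebesgue. 0 < w x) \<and> locally_integrable w"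

definition conj_exp :: "real \<Rightarrow> real" where
  "conj_exp p = p / (p - 1)"

text \<open>
  On the null set where \<open>w = 0\<close> the values of \<open>w powr _\<close> (and of \<open>ln w\<close>) are irrelevant.
  The integral of \<open>w powr (- p'/p)\<close> may be infinite; since \<open>w > 0\<close> almost everywhere, the
  first factor is then nonzero and the product is infinite.
\<close>

definition Ap_const :: "('a::euclidean_space \<Rightarrow> real) \<Rightarrow> real \<Rightarrow> real \<Rightarrow> ('a \<Rightarrow> real) \<Rightarrow> ennreal" where
  "Ap_const V p \<theta> w =
     (SUP c. SUP l\<in>{0<..}.
        ((\<integral>\<^sup>+ y\<in>cube c l. ennreal (w y) \<partial>lebesgue)
           / (ennreal (psi V \<theta> c l) * emeasure lebesgue (cube c l))) *
        ennpowr ((\<integral>\<^sup>+ y\<in>cube c l. ennreal (w y powr (- (conj_exp p / p))) \<partial>lebesgue)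
           / (ennreal (psi V \<theta> c l) * emeasure lebesgue (cube c l))) (p / conj_exp p))"

definition Ap :: "('a::euclidean_space \<Rightarrow> real) \<Rightarrow> real \<Rightarrow> real \<Rightarrow> ('a \<Rightarrow> real) set" where
  "Ap V p \<theta> = {w. weight w \<and> Ap_const V p \<theta> w < \<infinity>}"

definition Ap_inf :: "('a::euclidean_space \<Rightarrow> real) \<Rightarrow> real \<Rightarrow> ('a \<Rightarrow> real) set" where
  "Ap_inf V p = (\<Union>\<theta>\<in>{0..}. Ap V p \<theta>)"

definition average :: "'a::euclidean_space set \<Rightarrow> ('a \<Rightarrow> real) \<Rightarrow> real" where
  "average Q f = (LINT y:Q|lebesgue. f y) / measure lebesgue Q"

definition BMO_seminorm :: "('a::euclidean_space \<Rightarrow> real) \<Rightarrow> real \<Rightarrow> ('a \<Rightarrow> real) \<Rightarrow> ennreal" where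
  "BMO_seminorm V \<theta> f =
     (SUP c. SUP l\<in>{0<..}.
        (\<integral>\<^sup>+ y\<in>cube c l. ennreal \<bar>f y - average (cube c l) f\<bar> \<partial>lebesgue)
          / (ennreal (psi V \<theta> c l) * emeasure lebesgue (cube c l)))"

definition BMO :: "('a::euclidean_space \<Rightarrow> real) \<Rightarrow> real \<Rightarrow> ('a \<Rightarrow> real) set" where
  "BMO V \<theta> = {f. locally_integrable f \<and> BMO_seminorm V \<theta> f < \<infinity>}"

definition BMO_inf :: "('a::euclidean_space \<Rightarrow> real) \<Rightarrow> ('a \<Rightarrow> real) set" where
  "BMO_inf V = (\<Union>\<theta>\<in>{0..}. BMO V \<theta>)"

end

theory Submission
  imports Defs "HOL-Real_Asymp.Real_Asymp"
begin

text \<open>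
  Fix a cube \<open>Q\<close> and put \<open>q = 1 / (p - 1)\<close> and \<open>u = \<langle>w\<rangle>\<^sub>Q\<close>. Integrating
  \<open>\<bar>t\<bar> \<le> e\<^sup>t + e\<^sup>-\<^sup>q\<^sup>t / q\<close> at \<open>t = ln (w / u)\<close> bounds the mean of \<open>\<bar>ln w - ln u\<bar>\<close> over \<open>Q\<close> by
  \<open>1\<close> plus a multiple of the \<open>q\<close>-th power of the \<open>A\<^sub>p\<close> product of \<open>Q\<close>, hence by a
  constant times \<open>\<psi>\<^sub>\<theta>(Q)\<close> to the power \<open>1 + q\<close>.

  For the converse take a constant potential with \<open>\<rho> = 1\<close> and \<open>w(x) = exp (x \<bullet> b)\<close> for a unit
  vector \<open>b\<close> of the basis. As \<open>ln w\<close> is Lipschitz, its mean oscillation is at most linear in the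
  side length, whereas the \<open>A\<^sub>p\<close> product of the cubes centred at \<open>0\<close> grows exponentially.
\<close>


section \<open>Cubes, their volume, and the factor \<open>psi\<close>\<close>

declare emeasure_completion [simp del]

lemma cube_sets [measurable, simp]: "cube c l \<in> sets lebesgue"
  by (simp add: cube_def)

lemma compact_cube [simp]: "compact (cube c l)"
  by (simp add: cube_def compact_cbox)

lemma mem_cube:
  "y \<in> cube c l \<longleftrightarrow> (\<forall>i\<in>Basis. c \<bullet> i - l / 2 \<le> y \<bullet> i \<and> y \<bullet> i \<le> c \<bullet> i + l / 2)"
  by (auto simp: cube_def mem_box inner_diff_left inner_add_left)

lemma emeasure_cube:
  assumes "0 \<le> l"
  shows "emeasure lebesgue (cube (c :: 'a::euclidean_space) l) = ennreal (l ^ DIM('a))"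
proof -
  have "emeasure lborel (cube c l) = ennreal (\<Prod>b\<in>(Basis :: 'a set). l)"
    unfolding cube_def using assms
    by (subst emeasure_lborel_cbox)
      (auto simp: inner_diff_left inner_add_left intro!: arg_cong[where f = ennreal] prod.cong)
  then show ?thesis by (simp add: cube_def emeasure_completion)
qed

lemma compact_subset_cube:
  fixes K :: "'a::euclidean_space set"
  assumes "compact K"
  obtains l where "0 < l" "K \<subseteq> cube 0 l"
proof -
  from assms obtain B where B: "0 < B" "\<And>x. x \<in> K \<Longrightarrow> norm x \<le> B"
    using compact_imp_bounded[THEN bounded_pos[THEN iffD1]] by metis
  have "K \<subseteq> cube 0 (2 * B)"
  proof
    fix x assume "x \<in> K"
    then have "\<bar>x \<bullet> i\<bar> \<le> B" if "i \<in> Basis" for i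
      using Basis_le_norm[OF that, of x] B(2)[of x] by linarith
    then show "x \<in> cube 0 (2 * B)" by (simp add: mem_cube abs_le_iff minus_le_iff)
  qed
  with B(1) show thesis by (intro that[of "2 * B"]) auto
qed

lemma psi_ge_1: "0 \<le> \<theta> \<Longrightarrow> 1 \<le> psi V \<theta> c l"
  by (simp add: psi_def ge_one_powr_ge_zero)

lemma psi_pos: "0 < psi V \<theta> c l"
proof -
  have "0 < 1 + enn2real (ennreal l / critical_fun V c)"
    by (simp add: add_pos_nonneg)
  then show ?thesis by (simp add: psi_def)
qed

section \<open>Local integrability, integrals over cubes, and a criterion for BMO\<close>

text \<open>At each point the truncations of \<open>f\<close> to balls of integer radius are
  eventually equal to \<open>f\<close>, and each truncation is integrable, hence measurable.\<close>

lemma locally_integrable_measurable: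
  fixes f :: "'a::euclidean_space \<Rightarrow> real"
  assumes "locally_integrable f"
  shows "f \<in> borel_measurable lebesgue"
proof (rule borel_measurable_LIMSEQ_real)
  fix x :: 'a
  have "\<forall>\<^sub>F n in sequentially. norm x \<le> real n"
    using eventually_ge_at_top[of "nat \<lceil>norm x\<rceil>"] by eventually_elim linarith
  then show "(\<lambda>n. indicat_real (cball 0 (real n)) x *\<^sub>R f x) \<longlonglongrightarrow> f x"
    by (intro tendsto_eventually) (erule eventually_mono, simp)
next
  show "(\<lambda>x. indicat_real (cball 0 (real n)) x *\<^sub>R f x) \<in> borel_measurable lebesgue" for n
    using assms unfolding locally_integrable_def set_integrable_def
    by (intro borel_measurable_integrable) auto
qed

text \<open>A compact set is bounded, so it lies in some cube centred at 0; integrability over that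
  cube passes to the closed subset.\<close>

lemma locally_integrableI:
  fixes f :: "'a::euclidean_space \<Rightarrow> real"
  assumes [measurable]: "f \<in> borel_measurable lebesgue"
    and fin: "\<And>l. 0 < l \<Longrightarrow> (\<integral>\<^sup>+ y\<in>cube 0 l. ennreal \<bar>f y\<bar> \<partial>lebesgue) < \<infinity>"
  shows "locally_integrable f"
  unfolding locally_integrable_def
proof (intro allI impI)
  fix K :: "'a set"
  assume "compact K"
  then obtain l where l: "0 < l" "K \<subseteq> cube 0 l" by (rule compact_subset_cube)
  have "(\<lambda>x. indicat_real (cube 0 l) x *\<^sub>R f x) \<in> borel_measurable lebesgue"
    by (intro borel_measurable_scaleR borel_measurable_indicator) auto
  moreover have "(\<integral>\<^sup>+ x. ennreal (norm (indicat_real (cube 0 l) x *\<^sub>R f x)) \<partial>lebesgue)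
      = (\<integral>\<^sup>+ y\<in>cube 0 l. ennreal \<bar>f y\<bar> \<partial>lebesgue)"
    by (intro nn_integral_cong) (simp split: split_indicator)
  ultimately have "f absolutely_integrable_on (cube 0 l)"
    unfolding set_integrable_def using fin[OF l(1)] by (intro integrableI_bounded) auto
  then show "f absolutely_integrable_on K"
    by (rule set_integrable_subset) (use \<open>compact K\<close> l in \<open>auto simp: compact_imp_closed\<close>)
qed

lemma nn_integral_const_cube:
  assumes "0 \<le> l" "0 \<le> a"
  shows "(\<integral>\<^sup>+ y\<in>cube (c :: 'a::euclidean_space) l. ennreal a \<partial>lebesgue) = ennreal (a * l ^ DIM('a))"
  using assms by (simp add: nn_integral_cmult_indicator emeasure_cube ennreal_mult)

lemma nn_integral_cube_mono:
  assumes "\<And>y. y \<in> cube c l \<Longrightarrow> f y \<le> g y"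
  shows "(\<integral>\<^sup>+ y\<in>cube c l. f y \<partial>lebesgue) \<le> (\<integral>\<^sup>+ y\<in>cube c l. g y \<partial>lebesgue)"
  using assms by (intro nn_integral_mono) (auto split: split_indicator)

lemma continuous_locally_integrable:
  fixes f :: "'a::euclidean_space \<Rightarrow> real"
  assumes "continuous_on UNIV f"
  shows "locally_integrable f"
  unfolding locally_integrable_def
proof (intro allI impI)
  fix K :: "'a set"
  assume "compact K"
  moreover have "continuous_on K f" using assms by (rule continuous_on_subset) simp
  ultimately have "integrable lborel (\<lambda>x. indicat_real K x *\<^sub>R f x)"
    by (rule borel_integrable_compact)
  \<comment> \<open>For an integrand measurable with respect to \<open>lborel\<close>, integrability
    over \<open>lborel\<close> and over its completion \<open>lebesgue\<close> agree.\<close>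
  then show "f absolutely_integrable_on K"
    unfolding set_integrable_def
    by (subst integrable_completion) (auto dest: borel_measurable_integrable)
qed

text \<open>Any family of constants may replace the averages, at the cost of a factor \<open>2\<close>.\<close>

lemma BMO_memI:
  fixes f :: "'a::euclidean_space \<Rightarrow> real"
  assumes f: "locally_integrable f" and B: "0 \<le> B"
    and osc: "\<And>c l. 0 < l \<Longrightarrow> \<exists>a. (\<integral>\<^sup>+ y\<in>cube c l. ennreal \<bar>f y - a\<bar> \<partial>lebesgue)
                \<le> ennreal (B * (psi V \<theta> c l * l ^ DIM('a)))"
  shows "f \<in> BMO V \<theta>"
proof -
  have [measurable]: "f \<in> borel_measurable lebesgue"
    using f by (rule locally_integrable_measurable)
  have "(\<integral>\<^sup>+ y\<in>cube c l. ennreal \<bar>f y - average (cube c l) f\<bar> \<partial>lebesgue)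
          / (ennreal (psi V \<theta> c l) * emeasure lebesgue (cube c l)) \<le> ennreal (2 * B)"
    if l: "0 < l" for c l
  proof -
    define Q where "Q = cube c l"
    define m where "m = l ^ DIM('a)"
    define P where "P = psi V \<theta> c l"
    have m: "0 < m" and P: "0 < P" using l psi_pos by (auto simp: m_def P_def)
    have [measurable]: "Q \<in> sets lebesgue" by (simp add: Q_def)
    have eQ: "emeasure lebesgue Q = ennreal m" using l by (simp add: Q_def m_def emeasure_cube)
    then have mQ: "measure lebesgue Q = m" using m by (simp add: measure_def)
    obtain a where a: "(\<integral>\<^sup>+ y\<in>Q. ennreal \<bar>f y - a\<bar> \<partial>lebesgue) \<le> ennreal (B * (P * m))"
      using osc[OF l] unfolding Q_def P_def m_def by blast
    have fQ: "set_integrable lebesgue Q f"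
      using f by (simp add: Q_def locally_integrable_def)
    have aQ: "set_integrable lebesgue Q (\<lambda>_. a)"
      using eQ by (simp add: set_integrable_def)
    have dQ: "set_integrable lebesgue Q (\<lambda>y. f y - a)"
      using fQ aQ by (rule set_integral_diff)
    have nQ: "set_integrable lebesgue Q (\<lambda>y. \<bar>f y - a\<bar>)"
      using dQ by (rule set_integrable_abs)
    have "(LINT y:Q|lebesgue. \<bar>f y - a\<bar>) \<le> B * (P * m)"
    proof -
      have "(\<integral>\<^sup>+ y\<in>Q. ennreal \<bar>f y - a\<bar> \<partial>lebesgue)
          = (\<integral>\<^sup>+ y. ennreal (indicat_real Q y *\<^sub>R \<bar>f y - a\<bar>) \<partial>lebesgue)"
        by (intro nn_integral_cong) (simp split: split_indicator)
      also have "\<dots> = ennreal (LINT y:Q|lebesgue. \<bar>f y - a\<bar>)"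
        unfolding set_lebesgue_integral_def
        by (rule nn_integral_eq_integral) (use nQ in \<open>auto simp: set_integrable_def\<close>)
      finally show ?thesis using a B m P by (simp add: ennreal_le_iff)
    qed
    moreover have "\<bar>LINT y:Q|lebesgue. f y - a\<bar> \<le> (LINT y:Q|lebesgue. \<bar>f y - a\<bar>)"
      using set_integral_norm_bound[OF dQ] by simp
    \<comment> \<open>The mean of \<open>f - a\<close> over \<open>Q\<close> is
      \<open>average Q f - a\<close>, so the average is no farther from \<open>a\<close> than the
      mean of \<open>\<bar>f - a\<bar>\<close>, which is at most \<open>B * P\<close>.\<close>
    moreover have "(LINT y:Q|lebesgue. f y - a) = m * (average Q f - a)"
    proof -
      have "(LINT y:Q|lebesgue. f y - a) = (LINT y:Q|lebesgue. f y) - (LINT y:Q|lebesgue. a)"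
        using fQ aQ by (rule set_integral_diff)
      also have "(LINT y:Q|lebesgue. a) = m * a"
        using eQ mQ by (simp add: set_lebesgue_integral_def)
      finally show ?thesis using m mQ by (simp add: average_def right_diff_distrib)
    qed
    ultimately have avg: "m * \<bar>average Q f - a\<bar> \<le> B * (P * m)"
      using m by (simp only: abs_mult abs_of_pos order_trans)
    \<comment> \<open>Triangle inequality through \<open>a\<close>: each of the two summands
      integrates to at most \<open>B * (P * m)\<close>, which is the source of the factor 2.\<close>
    have "(\<integral>\<^sup>+ y\<in>Q. ennreal \<bar>f y - average Q f\<bar> \<partial>lebesgue)
        \<le> (\<integral>\<^sup>+ y. ennreal \<bar>f y - a\<bar> * indicator Q y
               + ennreal \<bar>average Q f - a\<bar> * indicator Q y \<partial>lebesgue)"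
      by (intro nn_integral_mono)
        (auto split: split_indicator simp flip: ennreal_plus intro!: ennreal_leI)
    also have "\<dots> = (\<integral>\<^sup>+ y\<in>Q. ennreal \<bar>f y - a\<bar> \<partial>lebesgue)
               + (\<integral>\<^sup>+ y\<in>Q. ennreal \<bar>average Q f - a\<bar> \<partial>lebesgue)"
      by (rule nn_integral_add) measurable
    also have "\<dots> \<le> ennreal (B * (P * m)) + ennreal (B * (P * m))"
    proof (rule add_mono[OF a])
      have "(\<integral>\<^sup>+ y\<in>Q. ennreal \<bar>average Q f - a\<bar> \<partial>lebesgue) = ennreal (\<bar>average Q f - a\<bar> * m)"
        unfolding Q_def m_def by (rule nn_integral_const_cube) (use l in auto)
      also have "\<dots> \<le> ennreal (B * (P * m))"
        using avg by (intro ennreal_leI) (simp only: mult.commute)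
      finally show "(\<integral>\<^sup>+ y\<in>Q. ennreal \<bar>average Q f - a\<bar> \<partial>lebesgue) \<le> ennreal (B * (P * m))" .
    qed
    also have "\<dots> = ennreal (P * m) * ennreal (2 * B)"
      using B m P by (simp flip: ennreal_plus ennreal_mult add: field_simps)
    finally show ?thesis
      using m P unfolding Q_def[symmetric] P_def[symmetric] eQ
      by (intro divide_le_posI_ennreal) (auto simp flip: ennreal_mult)
  qed
  then have "BMO_seminorm V \<theta> f \<le> ennreal (2 * B)"
    unfolding BMO_seminorm_def by (intro SUP_least) auto
  then have "BMO_seminorm V \<theta> f < \<infinity>" by (rule le_less_trans) simp
  with f show ?thesis by (simp add: BMO_def)
qed

section \<open>Oscillation of the logarithm of an A_p weight\<close>

lemma conj_exp_div: "1 < p \<Longrightarrow> conj_exp p / p = 1 / (p - 1)"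
  by (simp add: conj_exp_def)

lemma div_conj_exp: "1 < p \<Longrightarrow> p / conj_exp p = p - 1"
  by (simp add: conj_exp_def)

text \<open>Use 1 + s \<le> e^s with s = t if t \<ge> 0 and with s = -qt if t < 0; the remaining
  exponential is positive.\<close>

lemma abs_le_exp_add_exp:
  fixes q t :: real
  assumes "0 < q"
  shows "\<bar>t\<bar> \<le> exp t + exp (- (q * t)) / q"
proof (cases "0 \<le> t")
  case True
  have "t \<le> exp t" using exp_ge_add_one_self[of t] by linarith
  moreover have "0 \<le> exp (- (q * t)) / q" using assms by simp
  ultimately show ?thesis using True by linarith
next
  case False
  have "- (q * t) \<le> exp (- (q * t))" using exp_ge_add_one_self[of "- (q * t)"] by linarith
  then have "- t \<le> exp (- (q * t)) / q" using assms by (simp add: field_simps)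
  moreover have "0 \<le> exp t" by simp
  ultimately show ?thesis using False by linarith
qed

lemma ennpowr_ennreal: "0 \<le> x \<Longrightarrow> ennpowr (ennreal x) a = ennreal (x powr a)"
  by (simp add: ennpowr_def)

text \<open>The smaller side is a real lower bound, while \<open>y\<close> may be infinite, in which
  case its power is infinite too.\<close>

lemma ennpowr_mono:
  assumes "ennreal x \<le> y" "0 \<le> x" "0 \<le> a"
  shows "ennreal (x powr a) \<le> ennpowr y a"
  using assms by (cases y) (auto simp: ennpowr_def intro!: ennreal_leI powr_mono2)

text \<open>One term of the supremum, with p'/p = 1/(p-1), p/p' = p-1 and |Q| = l^n substituted. The
  first half of the theorem draws upper bounds from it, the second half contradicts it.\<close>

lemma Ap_const_cube_le:
  fixes w :: "'a::euclidean_space \<Rightarrow> real"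
  assumes "1 < p" "Ap_const V p \<theta> w \<le> K" "0 < l"
  shows "(\<integral>\<^sup>+ y\<in>cube c l. ennreal (w y) \<partial>lebesgue) / ennreal (psi V \<theta> c l * l ^ DIM('a))
     * ennpowr ((\<integral>\<^sup>+ y\<in>cube c l. ennreal (w y powr - (1 / (p - 1))) \<partial>lebesgue)
           / ennreal (psi V \<theta> c l * l ^ DIM('a))) (p - 1) \<le> K"
proof -
  have "ennreal (psi V \<theta> c l) * emeasure lebesgue (cube c l) = ennreal (psi V \<theta> c l * l ^ DIM('a))"
    using assms(3) psi_pos[of V \<theta> c l] by (simp add: emeasure_cube ennreal_mult)
  moreover have "(\<integral>\<^sup>+ y\<in>cube c l. ennreal (w y) \<partial>lebesgue)
           / (ennreal (psi V \<theta> c l) * emeasure lebesgue (cube c l)) *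
        ennpowr ((\<integral>\<^sup>+ y\<in>cube c l. ennreal (w y powr (- (conj_exp p / p))) \<partial>lebesgue)
           / (ennreal (psi V \<theta> c l) * emeasure lebesgue (cube c l))) (p / conj_exp p)
        \<le> Ap_const V p \<theta> w"
    unfolding Ap_const_def using assms(3) by (intro SUP_upper2[of c] SUP_upper2[of l]) auto
  ultimately show ?thesis
    using assms(1,2) by (simp add: conj_exp_div div_conj_exp)
qed

text \<open>Finiteness is local integrability. If the integral were 0, then \<open>w\<close> would
  vanish a.e. on the cube, which by a.e. positivity would be a null set. Positivity is what allows
  taking the logarithm of the mean of \<open>w\<close>.\<close>

lemma weight_cube_integral:
  fixes w :: "'a::euclidean_space \<Rightarrow> real"
  assumes w: "weight w" and l: "0 < l"
  obtains i where "0 < i" "(\<integral>\<^sup>+ y\<in>cube c l. ennreal (w y) \<partial>lebesgue) = ennreal i"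
proof -
  have [measurable]: "w \<in> borel_measurable lebesgue"
    using w by (simp add: weight_def locally_integrable_measurable)
  let ?I = "\<integral>\<^sup>+ y\<in>cube c l. ennreal (w y) \<partial>lebesgue"
  have "set_integrable lebesgue (cube c l) w"
    using w by (simp add: weight_def locally_integrable_def)
  moreover have "?I = (\<integral>\<^sup>+ y. ennreal (norm (indicat_real (cube c l) y *\<^sub>R w y)) \<partial>lebesgue)"
    using w by (intro nn_integral_cong) (simp add: weight_def split: split_indicator)
  ultimately have "?I < \<infinity>" by (simp add: set_integrable_def integrable_iff_bounded)
  moreover have "?I \<noteq> 0"
  proof
    assume "?I = 0"
    then have "AE y in lebesgue. ennreal (w y) * indicator (cube c l) y = 0"
      by (subst (asm) nn_integral_0_iff_AE) measurable
    moreover have "AE y in lebesgue. 0 < w y" using w by (simp add: weight_def)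
    ultimately have "AE y in lebesgue. y \<notin> cube c l"
      by eventually_elim (auto simp: ennreal_eq_0_iff split: split_indicator_asm)
    then have "emeasure lebesgue (cube c l) = 0"
      by (subst (asm) AE_iff_measurable[OF _ refl]) auto
    with l show False by (simp add: emeasure_cube)
  qed
  ultimately show thesis
    using that[of "enn2real ?I"] by (simp add: enn2real_positive_iff less_top zero_less_iff_neq_zero)
qed

text \<open>The constant is \<open>ln u\<close> for the mean \<open>u\<close> of \<open>w\<close>,
  not the average of \<open>ln w\<close>: integrability of \<open>ln w\<close> is itself deduced
  from this bound. With \<open>v\<close> the mean of \<open>w powr - q\<close>, the two exponentials
  have means 1 and \<open>u powr q * v / q\<close>, and the A_p condition controls the
  latter.\<close>

lemma Ap_log_oscillation:
  fixes w :: "'a::euclidean_space \<Rightarrow> real"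
  assumes p: "1 < p" and w: "weight w" and A: "0 \<le> A" "Ap_const V p \<theta> w \<le> ennreal A"
    and \<theta>: "0 \<le> \<theta>" and l: "0 < l"
  shows "\<exists>a. (\<integral>\<^sup>+ y\<in>cube c l. ennreal \<bar>ln (w y) - a\<bar> \<partial>lebesgue)
     \<le> ennreal ((1 + (p - 1) * A powr (1 / (p - 1))) *
         (psi V (\<theta> * (1 + 1 / (p - 1))) c l * l ^ DIM('a)))"
proof -
  define q where "q = 1 / (p - 1)"
  define m where "m = l ^ DIM('a)"
  define P where "P = psi V \<theta> c l"
  define J where "J = (\<integral>\<^sup>+ y\<in>cube c l. ennreal (w y powr - q) \<partial>lebesgue)"
  have q: "0 < q" "q * (p - 1) = 1" using p by (simp_all add: q_def)
  have m: "0 < m" using l by (simp add: m_def)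
  have P: "0 < P" "1 \<le> P" using psi_pos psi_ge_1 \<theta> by (auto simp: P_def)
  have [measurable]: "w \<in> borel_measurable lebesgue"
    using w by (simp add: weight_def locally_integrable_measurable)
  obtain i where i: "0 < i" "(\<integral>\<^sup>+ y\<in>cube c l. ennreal (w y) \<partial>lebesgue) = ennreal i"
    using weight_cube_integral[OF w l] by metis
  have Ap: "ennreal (i / (P * m)) * ennpowr (J / ennreal (P * m)) (p - 1) \<le> ennreal A"
    using Ap_const_cube_le[OF p A(2) l, of c] i m P
    by (simp add: q_def m_def P_def J_def divide_ennreal)
  \<comment> \<open>The first A_p factor is positive, so an infinite \<open>J\<close> would make the
    product infinite.\<close>
  have "J \<noteq> \<infinity>"
  proof
    assume "J = \<infinity>"
    then have "ennpowr (J / ennreal (P * m)) (p - 1) = \<infinity>"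
      by (simp add: ennpowr_def ennreal_top_divide)
    then show False using Ap i m P by (simp add: ennreal_mult_top top_unique)
  qed
  then obtain j where j: "0 \<le> j" "J = ennreal j" by (cases J) auto
  define u where "u = i / m"
  define v where "v = j / m"
  have u: "0 < u" and v: "0 \<le> v" using i j m by (simp_all add: u_def v_def)
  have "ennreal (u / P * (v / P) powr (p - 1)) \<le> ennreal A"
  proof -
    have "J / ennreal (P * m) = ennreal (v / P)"
      using j m P by (simp only: divide_ennreal mult_pos_pos v_def divide_divide_eq_left mult.commute)
    then show ?thesis
      using Ap i m v P by (simp add: ennpowr_ennreal u_def mult.commute flip: ennreal_mult)
  qed
  \<comment> \<open>Since q(p-1) = 1, the power q reduces the exponent of \<open>v\<close> to 1; the
    denominators collect to P^(1+q), which is again a \<open>psi\<close>, with exponent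
    \<theta>(1+q).\<close>
  then have "(u / P * (v / P) powr (p - 1)) powr q \<le> A powr q"
    using A(1) q(1) u P by (intro powr_mono2) (auto simp: ennreal_le_iff)
  also have "(u / P * (v / P) powr (p - 1)) powr q = u powr q * v / (P powr q * P)"
    using u v P q by (simp add: powr_mult powr_divide powr_powr mult.commute)
  finally have "u powr q * v \<le> A powr q * P powr (1 + q)"
    using P by (simp add: field_simps powr_add)
  also have "P powr (1 + q) = psi V (\<theta> * (1 + q)) c l"
    by (simp add: P_def psi_def powr_powr)
  finally have uv: "u powr q * v \<le> A powr q * psi V (\<theta> * (1 + q)) c l" .
  have "(\<integral>\<^sup>+ y\<in>cube c l. ennreal \<bar>ln (w y) - ln u\<bar> \<partial>lebesgue)
     \<le> (\<integral>\<^sup>+ y. ennreal (1 / u) * (ennreal (w y) * indicator (cube c l) y)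
           + ennreal (u powr q / q) * (ennreal (w y powr - q) * indicator (cube c l) y) \<partial>lebesgue)"
  proof (rule nn_integral_mono_AE)
    \<comment> \<open>Where \<open>w y = 0\<close> the right-hand side is 0, because
      \<open>0 powr _ = 0\<close>; the comparison is therefore made almost everywhere.\<close>
    have "AE y in lebesgue. 0 < w y" using w by (simp add: weight_def)
    then show "AE y in lebesgue. ennreal \<bar>ln (w y) - ln u\<bar> * indicator (cube c l) y
        \<le> ennreal (1 / u) * (ennreal (w y) * indicator (cube c l) y)
           + ennreal (u powr q / q) * (ennreal (w y powr - q) * indicator (cube c l) y)"
    proof eventually_elim
      fix y assume y: "0 < w y"
      \<comment> \<open>For t = ln (w/u), e^t is w/u and e^(-qt) is u^q w^(-q).\<close>
      have "\<bar>ln (w y) - ln u\<bar> \<le> 1 / u * w y + u powr q / q * w y powr - q"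
        using abs_le_exp_add_exp[OF q(1), of "ln (w y) - ln u"] y u
        by (simp add: exp_diff powr_def exp_add[symmetric] algebra_simps)
      then show "ennreal \<bar>ln (w y) - ln u\<bar> * indicator (cube c l) y
        \<le> ennreal (1 / u) * (ennreal (w y) * indicator (cube c l) y)
           + ennreal (u powr q / q) * (ennreal (w y powr - q) * indicator (cube c l) y)"
        using y u q
        by (auto split: split_indicator simp flip: ennreal_mult ennreal_plus intro!: ennreal_leI)
    qed
  qed
  also have "\<dots> = ennreal (1 / u) * ennreal i + ennreal (u powr q / q) * J"
    unfolding J_def i(2)[symmetric] by (subst nn_integral_add) (auto simp: nn_integral_cmult)
  also have "\<dots> = ennreal (m + (p - 1) * (u powr q * v) * m)"
    using i j m u q p by (simp add: u_def v_def q_def flip: ennreal_mult ennreal_plus)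
  also have "\<dots> \<le> ennreal ((1 + (p - 1) * A powr q) * (psi V (\<theta> * (1 + q)) c l * m))"
  proof (rule ennreal_leI)
    \<comment> \<open>As \<open>psi\<close> is at least 1, the summand \<open>m\<close> from the
      first exponential is absorbed into the common bound.\<close>
    have "1 * m \<le> psi V (\<theta> * (1 + q)) c l * m"
      using \<theta> q m by (intro mult_right_mono psi_ge_1) auto
    moreover have "(p - 1) * (u powr q * v) * m \<le> (p - 1) * (A powr q * psi V (\<theta> * (1 + q)) c l) * m"
      using uv p m by (intro mult_right_mono mult_left_mono) auto
    ultimately show "m + (p - 1) * (u powr q * v) * m
        \<le> (1 + (p - 1) * A powr q) * (psi V (\<theta> * (1 + q)) c l * m)"
      by (simp add: algebra_simps)
  qed
  finally show ?thesis unfolding q_def m_def by blast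
qed

theorem ln_Ap_inf_BMO_inf:
  fixes w :: "'a::euclidean_space \<Rightarrow> real"
  assumes p: "1 < p" and "w \<in> Ap_inf V p"
  shows "(\<lambda>x. ln (w x)) \<in> BMO_inf V"
proof -
  from assms(2) obtain \<theta> where \<theta>: "0 \<le> \<theta>" and w: "weight w" and fin: "Ap_const V p \<theta> w < \<infinity>"
    by (auto simp: Ap_inf_def Ap_def)
  from fin obtain A where A: "0 \<le> A" "Ap_const V p \<theta> w \<le> ennreal A"
    by (cases "Ap_const V p \<theta> w") auto
  have [measurable]: "w \<in> borel_measurable lebesgue"
    using w by (simp add: weight_def locally_integrable_measurable)
  note osc = Ap_log_oscillation[OF p w A \<theta>]
  \<comment> \<open>On each cube centred at 0, \<open>ln w\<close> has finite L^1 distance from some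
    constant, hence finite L^1 norm.\<close>
  have "locally_integrable (\<lambda>x. ln (w x))"
  proof (rule locally_integrableI)
    fix l :: real assume l: "0 < l"
    obtain a where a: "(\<integral>\<^sup>+ y\<in>cube 0 l. ennreal \<bar>ln (w y) - a\<bar> \<partial>lebesgue) < \<infinity>"
      using osc[OF l, of 0] by (auto intro: le_less_trans[OF _ ennreal_less_top])
    have "(\<integral>\<^sup>+ y\<in>cube 0 l. ennreal \<bar>ln (w y)\<bar> \<partial>lebesgue)
       \<le> (\<integral>\<^sup>+ y. ennreal \<bar>ln (w y) - a\<bar> * indicator (cube 0 l) y
             + ennreal \<bar>a\<bar> * indicator (cube 0 l) y \<partial>lebesgue)"
      by (intro nn_integral_mono)
        (auto split: split_indicator simp flip: ennreal_plus intro!: ennreal_leI)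
    also have "\<dots> = (\<integral>\<^sup>+ y\<in>cube 0 l. ennreal \<bar>ln (w y) - a\<bar> \<partial>lebesgue)
        + (\<integral>\<^sup>+ y\<in>cube (0 :: 'a) l. ennreal \<bar>a\<bar> \<partial>lebesgue)"
      by (rule nn_integral_add) measurable
    also have "\<dots> < \<infinity>"
      using a l by (simp add: nn_integral_const_cube less_top)
    finally show "(\<integral>\<^sup>+ y\<in>cube 0 l. ennreal \<bar>ln (w y)\<bar> \<partial>lebesgue) < \<infinity>" .
  qed measurable
  then have "(\<lambda>x. ln (w x)) \<in> BMO V (\<theta> * (1 + 1 / (p - 1)))"
    using p A(1) osc by (intro BMO_memI[where B = "1 + (p - 1) * A powr (1 / (p - 1))"]) auto
  moreover have "0 \<le> \<theta> * (1 + 1 / (p - 1))" using \<theta> p by simp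
  ultimately show ?thesis unfolding BMO_inf_def by blast
qed

section \<open>The constant potential\<close>

text \<open>Normalised so that the critical function is identically \<open>1\<close>.\<close>

definition unit_potential :: "'a::euclidean_space \<Rightarrow> real" where
  "unit_potential x = 1 / unit_ball_vol (real DIM('a))"

text \<open>The potential integrates to r^n over a ball of radius r, so the quotient in the
  definition is r^2, which is at most 1 exactly for r \<le> 1. Dimension at least 2 keeps the
  natural-number exponent n - 2 from truncating.\<close>

lemma critical_fun_unit_potential:
  fixes x :: "'a::euclidean_space"
  assumes "2 \<le> DIM('a)"
  shows "critical_fun unit_potential x = 1"
proof -
  have *: "(\<integral>\<^sup>+ y\<in>ball x r. ennreal (unit_potential y) \<partial>lebesgue) / ennreal (r ^ (DIM('a) - 2))
      = ennreal (r\<^sup>2)" if "0 < r" for r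
  proof -
    have "(\<integral>\<^sup>+ y\<in>ball x r. ennreal (unit_potential y) \<partial>lebesgue) = ennreal (r ^ DIM('a))"
      using that less_imp_neq[OF unit_ball_vol_pos[of "real DIM('a)"]]
      by (simp add: unit_potential_def nn_integral_cmult_indicator emeasure_completion emeasure_ball
          flip: ennreal_mult)
    moreover have "r ^ DIM('a) = r\<^sup>2 * r ^ (DIM('a) - 2)"
      using assms by (simp only: le_add_diff_inverse flip: power_add)
    ultimately show ?thesis using that by (simp add: divide_ennreal)
  qed
  have "{r. 0 < r \<and> (\<integral>\<^sup>+ y\<in>ball x r. ennreal (unit_potential y) \<partial>lebesgue)
      / ennreal (r ^ (DIM('a) - 2)) \<le> 1} = {0<..1}"
    using * by (auto simp: power_le_one_iff abs_square_le_1)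
  moreover have "Sup (ennreal ` {0<..1::real}) = 1"
    by (rule cSup_eq_maximum) (auto intro: image_eqI[of _ _ 1])
  ultimately show ?thesis by (simp add: critical_fun_def)
qed

lemma psi_unit_potential:
  fixes c :: "'a::euclidean_space"
  assumes "2 \<le> DIM('a)" "0 \<le> l"
  shows "psi unit_potential \<theta> c l = (1 + l) powr \<theta>"
  using assms divide_ennreal[of l 1] by (simp add: psi_def critical_fun_unit_potential)

text \<open>Take s = \<infinity>: the essential supremum of a constant is at most that constant,
  which is also its mean, so the reverse Hoelder constant 1 works.\<close>

lemma admissible_unit_potential: "admissible (unit_potential :: 'a::euclidean_space \<Rightarrow> real)"
proof -
  define v where "v = 1 / unit_ball_vol (real DIM('a))"
  have v: "0 < v" by (simp add: v_def)
  have V: "(unit_potential :: 'a \<Rightarrow> real) = (\<lambda>_. v)" by (auto simp: unit_potential_def v_def)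
  have "power_mean \<infinity> (cube c l) (\<lambda>_. v) \<le> ennreal 1 *
      ((\<integral>\<^sup>+ y\<in>cube c l. ennreal v \<partial>lebesgue) / emeasure lebesgue (cube c l))"
    if "0 < l" for c :: 'a and l
  proof -
    have "power_mean \<infinity> (cube c l) (\<lambda>_. v) \<le> ennreal v"
      by (auto simp: power_mean_def intro!: esssup_I)
    also have "ennreal v = (\<integral>\<^sup>+ y\<in>cube c l. ennreal v \<partial>lebesgue) / emeasure lebesgue (cube c l)"
      using that v by (simp add: nn_integral_const_cube emeasure_cube divide_ennreal)
    finally show ?thesis by simp
  qed
  then have "reverse_Hoelder \<infinity> (\<lambda>_::'a. v)"
    unfolding reverse_Hoelder_def by blast
  then show ?thesis
    using v unfolding admissible_def V
    by (auto intro!: continuous_locally_integrable continuous_intros exI[of _ \<infinity>])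
qed

section \<open>The exponential weight\<close>

lemma cube_integral_ge:
  assumes "cube c' l' \<subseteq> cube c l" "0 \<le> l'" "0 \<le> a"
    "\<And>y :: 'a::euclidean_space. y \<in> cube c' l' \<Longrightarrow> a \<le> f y"
  shows "ennreal (a * l' ^ DIM('a)) \<le> (\<integral>\<^sup>+ y\<in>cube c l. ennreal (f y) \<partial>lebesgue)"
proof -
  have "ennreal (a * l' ^ DIM('a)) = (\<integral>\<^sup>+ y\<in>cube c' l'. ennreal a \<partial>lebesgue)"
    using assms(2,3) by (simp add: nn_integral_const_cube)
  also have "\<dots> \<le> (\<integral>\<^sup>+ y\<in>cube c l. ennreal (f y) \<partial>lebesgue)"
    using assms(1,4) by (intro nn_integral_mono) (auto split: split_indicator intro: ennreal_leI)
  finally show ?thesis .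
qed

context
  fixes b :: "'a::euclidean_space"
  assumes b: "b \<in> Basis" and dim: "2 \<le> DIM('a)"
begin

text \<open>On a cube, \<open>y \<bullet> b\<close> differs from its value at the centre by at most
  l/2, and 1 + l, which is \<open>psi\<close> for \<theta> = 1, dominates this.\<close>

lemma inner_BMO_inf_unit_potential: "(\<lambda>x. x \<bullet> b) \<in> BMO_inf unit_potential"
proof -
  have "(\<lambda>x. x \<bullet> b) \<in> BMO unit_potential 1"
  proof (rule BMO_memI)
    show "locally_integrable (\<lambda>x. x \<bullet> b)"
      by (intro continuous_locally_integrable continuous_intros)
    fix c :: 'a and l :: real
    assume l: "0 < l"
    have "(\<integral>\<^sup>+ y\<in>cube c l. ennreal \<bar>y \<bullet> b - c \<bullet> b\<bar> \<partial>lebesgue)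
        \<le> (\<integral>\<^sup>+ y\<in>cube c l. ennreal (1 + l) \<partial>lebesgue)"
      using b l by (intro nn_integral_cube_mono ennreal_leI) (force simp: mem_cube abs_le_iff)
    also have "\<dots> = ennreal ((1 + l) * l ^ DIM('a))"
      using l by (intro nn_integral_const_cube) auto
    finally show "\<exists>a. (\<integral>\<^sup>+ y\<in>cube c l. ennreal \<bar>y \<bullet> b - a\<bar> \<partial>lebesgue)
        \<le> ennreal (1 * (psi unit_potential 1 c l * l ^ DIM('a)))"
      using l dim by (auto simp: psi_unit_potential)
  qed simp
  then show ?thesis unfolding BMO_inf_def by force
qed

lemma weight_exp_inner: "weight (\<lambda>x. exp (x \<bullet> b))"
  by (auto simp: weight_def intro!: continuous_locally_integrable continuous_intros)

text \<open>On the cube of side l centred at 0 the mean of \<open>w\<close> is at least a fixed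
  multiple of e^(l/4) and that of the negative power is bounded below, while \<open>psi\<close>
  contributes only powers of 1 + l.\<close>

lemma exp_inner_notin_Ap_inf:
  assumes p: "1 < p"
  shows "(\<lambda>x. exp (x \<bullet> b)) \<notin> Ap_inf unit_potential p"
proof
  let ?w = "\<lambda>x. exp (x \<bullet> b)" and ?V = "unit_potential :: 'a \<Rightarrow> real"
  assume "?w \<in> Ap_inf ?V p"
  then obtain \<theta> where fin: "Ap_const ?V p \<theta> ?w < \<infinity>"
    by (auto simp: Ap_inf_def Ap_def)
  then obtain A where A: "0 \<le> A" "Ap_const ?V p \<theta> ?w \<le> ennreal A"
    by (cases "Ap_const ?V p \<theta> ?w") auto
  have bound: "exp (l / 4) \<le> A * (4 ^ DIM('a) * (1 + l) powr \<theta>) powr p" if l: "0 < l" for l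
  proof -
    define P where "P = (1 + l) powr \<theta>"
    define k where "k = inverse (4 ^ DIM('a) * P)"
    have P: "0 < P" using l by (simp add: P_def)
    then have k: "0 < k" by (simp add: k_def)
    \<comment> \<open>Two opposite corner cubes, each with the fraction 4^(-n) of the volume: the
      coordinates lie in [l/4, l/2] on the first, so the weight is at least e^(l/4), and in
      [-l/2, -l/4] on the second.\<close>
    have sub: "cube ((3 * l / 8) *\<^sub>R One) (l / 4) \<subseteq> cube (0 :: 'a) l"
      "cube (- ((3 * l / 8) *\<^sub>R One)) (l / 4) \<subseteq> cube (0 :: 'a) l"
      using l by (fastforce simp: mem_cube)+
    have "ennreal (exp (l / 4) * (l / 4) ^ DIM('a)) \<le> (\<integral>\<^sup>+ y\<in>cube 0 l. ennreal (?w y) \<partial>lebesgue)"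
      using l b by (intro cube_integral_ge[OF sub(1)]) (auto simp: mem_cube)
    then have "ennreal (exp (l / 4) * (l / 4) ^ DIM('a)) / ennreal (P * l ^ DIM('a))
        \<le> (\<integral>\<^sup>+ y\<in>cube 0 l. ennreal (?w y) \<partial>lebesgue) / ennreal (P * l ^ DIM('a))"
      by (rule divide_right_mono_ennreal)
    then have 1: "ennreal (exp (l / 4) * k)
        \<le> (\<integral>\<^sup>+ y\<in>cube 0 l. ennreal (?w y) \<partial>lebesgue) / ennreal (P * l ^ DIM('a))"
      using l P by (simp add: divide_ennreal k_def power_divide field_simps)
    have "ennreal (1 * (l / 4) ^ DIM('a))
        \<le> (\<integral>\<^sup>+ y\<in>cube 0 l. ennreal (?w y powr - (1 / (p - 1))) \<partial>lebesgue)"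
    proof (rule cube_integral_ge[OF sub(2)])
      fix y :: 'a
      assume "y \<in> cube (- ((3 * l / 8) *\<^sub>R One)) (l / 4)"
      \<comment> \<open>The crude lower bound 1 for the negative power suffices, as the first factor
        already grows exponentially.\<close>
      then have "y \<bullet> b \<le> 0" using l b by (auto simp: mem_cube)
      then show "1 \<le> ?w y powr - (1 / (p - 1))"
        using p by (simp add: powr_def divide_nonpos_pos)
    qed (use l in auto)
    then have "ennreal (1 * (l / 4) ^ DIM('a)) / ennreal (P * l ^ DIM('a))
        \<le> (\<integral>\<^sup>+ y\<in>cube 0 l. ennreal (?w y powr - (1 / (p - 1))) \<partial>lebesgue) / ennreal (P * l ^ DIM('a))"
      by (rule divide_right_mono_ennreal)
    then have "ennreal k
        \<le> (\<integral>\<^sup>+ y\<in>cube 0 l. ennreal (?w y powr - (1 / (p - 1))) \<partial>lebesgue) / ennreal (P * l ^ DIM('a))"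
      using l P by (simp add: divide_ennreal k_def power_divide field_simps)
    then have 2: "ennreal (k powr (p - 1)) \<le> ennpowr
        ((\<integral>\<^sup>+ y\<in>cube 0 l. ennreal (?w y powr - (1 / (p - 1))) \<partial>lebesgue) / ennreal (P * l ^ DIM('a)))
        (p - 1)"
      using k p by (intro ennpowr_mono) auto
    \<comment> \<open>The first factor contributes \<open>k\<close> and the second
      \<open>k powr (p - 1)\<close>, together \<open>k powr p\<close>; its inverse gives the power p
      in \<open>bound\<close>.\<close>
    have "ennreal (exp (l / 4) * k * k powr (p - 1)) \<le> ennreal A"
      using mult_mono[OF 1 2] Ap_const_cube_le[OF p A(2) l, of 0] k l dim
      by (simp add: psi_unit_potential P_def ennreal_mult order_trans)
    then have "exp (l / 4) * (k * k powr (p - 1)) \<le> A"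
      using A(1) by (simp add: ennreal_le_iff mult.assoc)
    also have "k * k powr (p - 1) = k powr p"
      using k powr_add[of k 1 "p - 1"] by simp
    finally show ?thesis
      using P by (simp add: k_def P_def powr_divide inverse_eq_divide divide_le_eq)
  qed
  \<comment> \<open>Letting l tend to infinity, the exponential outgrows every power of 1 + l,
    against \<open>bound\<close>.\<close>
  have "filterlim (\<lambda>l::real. exp (l / 4) / (1 + l) powr (\<theta> * p)) at_top at_top"
    by real_asymp
  then have "\<forall>\<^sub>F l in at_top. exp (l / 4) / (1 + l) powr (\<theta> * p) > A * (4 ^ DIM('a)) powr p"
    by (rule filterlim_at_top_dense[THEN iffD1, rule_format])
  moreover have "\<forall>\<^sub>F l :: real in at_top. 0 < l" by (rule eventually_gt_at_top)
  ultimately have "\<forall>\<^sub>F l :: real in at_top. False"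
  proof eventually_elim
    case (elim l)
    then have "A * (4 ^ DIM('a)) powr p * (1 + l) powr (\<theta> * p) < exp (l / 4)"
      by (simp add: less_divide_eq)
    with bound[OF elim(2)] elim(2) show False
      by (simp add: powr_mult powr_powr)
  qed
  then show False by simp
qed

end

theorem theorem1p5:
  fixes p :: real
  assumes "CARD('n::finite) \<ge> 3" and "1 < p"
  shows "(\<forall>V :: real ^ 'n \<Rightarrow> real. admissible V \<longrightarrow>
            (\<forall>w. w \<in> Ap_inf V p \<longrightarrow> (\<lambda>x. ln (w x)) \<in> BMO_inf V)) \<and>
         (\<exists>V :: real ^ 'n \<Rightarrow> real. admissible V \<and>
            (\<exists>w. weight w \<and> (\<lambda>x. ln (w x)) \<in> BMO_inf V \<and> w \<notin> Ap_inf V p))"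
proof (intro conjI allI impI)
  fix V w :: "real ^ 'n \<Rightarrow> real"
  assume "w \<in> Ap_inf V p"
  with assms(2) show "(\<lambda>x. ln (w x)) \<in> BMO_inf V" by (rule ln_Ap_inf_BMO_inf)
next
  obtain b :: "real ^ 'n" where b: "b \<in> Basis" using nonempty_Basis by blast
  have dim: "2 \<le> DIM(real ^ 'n)" using assms(1) by simp
  show "\<exists>V :: real ^ 'n \<Rightarrow> real. admissible V \<and>
            (\<exists>w. weight w \<and> (\<lambda>x. ln (w x)) \<in> BMO_inf V \<and> w \<notin> Ap_inf V p)"
    \<comment> \<open>The logarithm of the weight simplifies to the linear function
      \<open>x \<bullet> b\<close>, whose oscillation is already bounded.\<close>
    using admissible_unit_potential weight_exp_inner[OF b dim]
      inner_BMO_inf_unit_potential[OF b dim] exp_inner_notin_Ap_inf[OF b dim assms(2)]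
    by (intro exI[of _ unit_potential] exI[of _ "\<lambda>x. exp (x \<bullet> b)"] conjI) simp_all
qed

end
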